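(* Let $r\ge 1$ be the number of identical items. Let $\mathsf N$ be a set of non-colluding bidders, $\mathsf C$ a set of colluding bidders, and $\mathsf N'$ a set of additional non-colluding bidders (the three sets being pairwise disjoint) with $|\mathsf N'|=|\mathsf C|$. If the non-negative valuations $v_i$ of all bidders are independent and identically distributed, then $$\mathbb{E}\bigl[\mathtt{Wel}_{\mathrm{VCG}}(\mathsf N\cup\mathsf N',\mathsf C)\bigr]\ \ge\ \mathbb{E}\bigl[\mathtt{Wel}_{\mathrm{OPT}}(\mathsf N\cup\mathsf C)\bigr].$$
   Context: Setting: $r$ identical items are sold to single-minded bidders, each wanting at most one item. Bidder $i$ has private valuation $v_i\ge 0$ and submits bid $b_i\ge0$. Given the bids, a mechanism outputs allocations $x_i\in\{0,1\}$ (at most $r$ items in total) and payments $p_i$. Welfare is $\sum_i v_i x_i$. VCG mechanism: the $r$ highest bids win, and each winner pays the $(r+1)$-st highest bid (bids of non-existing ranks are $0$); losers pay nothing. Collusion model: each non-colluding bidder maximizes $v_ix_i-p_i$ and bids truthfully under VCG. The colluders act as one entity that knows its members' valuations, chooses all their bids jointly to maximize $\sum_{i\in\mathsf C}(v_ix_i-p_i)$, and may exchange items and money internally (so items won by the coalition are held by its highest-valuation members). $\mathtt{Wel}_{\mathrm{VCG}}(\mathsf A,\mathsf C)$ is the welfare under VCG when $\mathsf A$ is the set of non-colluders (bidding truthfully) and $\mathsf C$ the set of colluders, who play optimal joint bids against the non-colluders' bids; the optimal joint bids are taken of the form in which every colluder bids either $0$ or her true valuation. $\mathtt{Wel}_{\mathrm{OPT}}(\mathsf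 M)$ is the welfare of an efficient (welfare-maximizing, possibly not truthful) mechanism for the bidder set $\mathsf M$, i.e. the sum of the $r$ largest true valuations in $\mathsf M$ (all of them if $|\mathsf M|\le r$). *)

theory Defs
  imports "HOL-Probability.Probability" "HOL-Library.Multiset"
begin

definition ranked :: "('i \<Rightarrow> real) \<Rightarrow> 'i set \<Rightarrow> real list" where
  "ranked f S = rev (sorted_list_of_multiset (image_mset f (mset_set S)))"

text \<open>The sum of the \<open>k\<close> largest values in \<open>S\<close>; all of them if \<open>S\<close> has at most \<open>k\<close> elements.\<close>

definition top_sum :: "nat \<Rightarrow> ('i \<Rightarrow> real) \<Rightarrow> 'i set \<Rightarrow> real" where
  "top_sum k f S = sum_list (take k (ranked f S))"

definition wel_opt :: "nat \<Rightarrow> ('i \<Rightarrow> real) \<Rightarrow> 'i set \<Rightarrow> real" where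
  "wel_opt r v S = top_sum r v S"

text \<open>
  A VCG winner determination maps a bid profile to its set of winners. Ties between equal bids
  may be resolved in any way, and if there are at most \<open>r\<close> bidders then all of them win.
\<close>

definition vcg_rule :: "nat \<Rightarrow> 'i set \<Rightarrow> (('i \<Rightarrow> real) \<Rightarrow> 'i set) \<Rightarrow> bool" where
  "vcg_rule r I W \<longleftrightarrow>
     (\<forall>b. (\<forall>i\<in>I. 0 \<le> b i) \<longrightarrow>
        W b \<subseteq> I \<and> card (W b) = min r (card I) \<and> (\<forall>i\<in>W b. \<forall>j\<in>I - W b. b j \<le> b i))"

text \<open>The \<open>(r + 1)\<close>-st highest bid; it sits at index \<open>r\<close>, as list positions are counted from 0.\<close>

definition vcg_price :: "nat \<Rightarrow> 'i set \<Rightarrow> ('i \<Rightarrow> real) \<Rightarrow> real" where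
  "vcg_price r I b = (if r < card I then ranked b I ! r else 0)"

definition joint_bids :: "'i set \<Rightarrow> ('i \<Rightarrow> real) \<Rightarrow> ('i \<Rightarrow> real) \<Rightarrow> 'i \<Rightarrow> real" where
  "joint_bids C v c i = (if i \<in> C then c i else v i)"

definition coalition_items ::
    "(('i \<Rightarrow> real) \<Rightarrow> 'i set) \<Rightarrow> 'i set \<Rightarrow> ('i \<Rightarrow> real) \<Rightarrow> ('i \<Rightarrow> real) \<Rightarrow> nat" where
  "coalition_items W C v c = card (W (joint_bids C v c) \<inter> C)"

text \<open>
  In the next two definitions \<open>A\<close> is the set of truthful bidders, \<open>C\<close> the coalition, \<open>v\<close> the
  valuations and \<open>c\<close> the bids of the coalition. The coalition may exchange items internally, so
  the \<open>k\<close> items it wins are worth the sum of its \<open>k\<close> highest valuations, whichever members won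
  them; internal money transfers cancel.
\<close>

definition coalition_utility ::
    "nat \<Rightarrow> (('i \<Rightarrow> real) \<Rightarrow> 'i set) \<Rightarrow> 'i set \<Rightarrow> 'i set \<Rightarrow> ('i \<Rightarrow> real) \<Rightarrow> ('i \<Rightarrow> real) \<Rightarrow> real" where
  "coalition_utility r W A C v c =
     top_sum (coalition_items W C v c) v C
     - real (coalition_items W C v c) * vcg_price r (A \<union> C) (joint_bids C v c)"

definition wel_vcg ::
    "(('i \<Rightarrow> real) \<Rightarrow> 'i set) \<Rightarrow> 'i set \<Rightarrow> 'i set \<Rightarrow> ('i \<Rightarrow> real) \<Rightarrow> ('i \<Rightarrow> real) \<Rightarrow> real" where
  "wel_vcg W A C v c =
     (\<Sum>i\<in>W (joint_bids C v c) \<inter> A. v i) + top_sum (coalition_items W C v c) v C"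

definition optimal_bids ::
    "nat \<Rightarrow> (('i \<Rightarrow> real) \<Rightarrow> 'i set) \<Rightarrow> 'i set \<Rightarrow> 'i set \<Rightarrow> ('i \<Rightarrow> real) \<Rightarrow> ('i \<Rightarrow> real) \<Rightarrow> bool" where
  "optimal_bids r W A C v c \<longleftrightarrow>
     (\<forall>i\<in>C. 0 \<le> c i) \<and>
     (\<forall>d. (\<forall>i\<in>C. 0 \<le> d i) \<longrightarrow> coalition_utility r W A C v d \<le> coalition_utility r W A C v c)"

end

theory Submission
  imports Defs
begin

text \<open>
  Playing all-zero bids never gives the coalition a negative utility, so under optimal bids the
  \<open>k\<close> items of the coalition are worth at least \<open>k\<close> times the price \<open>p\<close>. Winning bids are at least
  \<open>p\<close> and losing bids at most \<open>p\<close>, so reassigning those items to the best non-colluders would gain at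
  most \<open>k p\<close>. Hence the VCG welfare is, pointwise, at least the optimal welfare of the non-colluders
  \<open>N \<union> N'\<close>, and the latter is distributed like the optimal welfare of \<open>N \<union> C\<close>.
\<close>

section \<open>Ranked values\<close>

text \<open>The ascending list of \<open>T\<close> followed by that of \<open>S\<close> is already
  sorted, and a sorted list is determined by its multiset; \<open>rev\<close> then swaps the two
  blocks.\<close>

lemma ranked_Un:
  assumes "finite S" "finite T" "S \<inter> T = {}" "\<forall>i\<in>S. \<forall>j\<in>T. f j \<le> f i"
  shows "ranked f (S \<union> T) = ranked f S @ ranked f T"
proof -
  let ?l = "\<lambda>S. sorted_list_of_multiset (image_mset f (mset_set S))"
  have "sort (?l (S \<union> T)) = ?l T @ ?l S"
    by (rule properties_for_sort)
      (use assms in \<open>auto simp: mset_set_Union sorted_append add.commute\<close>)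
  then show ?thesis
    by (simp add: ranked_def)
qed

lemma length_ranked [simp]: "finite S \<Longrightarrow> length (ranked f S) = card S"
  by (simp add: ranked_def flip: size_mset)

lemma set_ranked [simp]: "finite S \<Longrightarrow> set (ranked f S) = f ` S"
  by (simp add: ranked_def)

lemma sum_list_ranked: "finite S \<Longrightarrow> sum_list (ranked f S) = sum f S"
  by (simp add: ranked_def sum_unfold_sum_mset flip: sum_mset_sum_list)

lemma sorted_ranked: "sorted (rev (ranked f S))"
  by (simp add: ranked_def)

lemma ranked_image: "inj_on g S \<Longrightarrow> ranked f (g ` S) = ranked (f \<circ> g) S"
  by (simp add: ranked_def flip: image_mset_mset_set multiset.map_comp)

lemma ranked_cong: "(\<And>i. i \<in> S \<Longrightarrow> f i = g i) \<Longrightarrow> ranked f S = ranked g S"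
  unfolding ranked_def
  by (cases "finite S") (auto intro!: arg_cong[of _ _ sorted_list_of_multiset] image_mset_cong)

text \<open>This identifies the price with the highest losing bid, however ties are broken: the
  winners \<open>U\<close> fill the positions below \<open>r\<close>, so index \<open>r\<close> is
  the head of the list of \<open>I - U\<close>.\<close>

lemma ranked_nth_separates:
  assumes "finite I" "U \<subseteq> I" "card U = r" "r < card I" "\<forall>i\<in>U. \<forall>j\<in>I - U. f j \<le> f i"
  shows "\<exists>l\<in>I - U. ranked f I ! r = f l \<and> (\<forall>j\<in>I - U. f j \<le> f l)"
proof -
  have fin: "finite U" "finite (I - U)"
    using assms by (auto intro: finite_subset)
  have ne: "ranked f (I - U) \<noteq> []"
    using assms fin by (metis card_Diff_subset length_ranked list.size(3) zero_less_diff less_numeral_extra(3))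
  have "ranked f I = ranked f U @ ranked f (I - U)"
    using ranked_Un[OF fin, of f] assms by (simp add: Un_absorb1)
  then have hd: "ranked f I ! r = hd (ranked f (I - U))"
    using assms(3) fin ne by (simp add: nth_append hd_conv_nth)
  obtain x xs where xs: "ranked f (I - U) = x # xs"
    using ne by (cases "ranked f (I - U)") auto
  have "\<forall>y\<in>set (x # xs). y \<le> x"
    using sorted_ranked[of f "I - U"] unfolding xs by (auto simp: sorted_append)
  moreover have "set (x # xs) = f ` (I - U)"
    using set_ranked[OF fin(2), of f] xs by simp
  moreover from this obtain l where "l \<in> I - U" "x = f l"
    by (metis imageE list.set_intros(1))
  ultimately have "\<forall>j\<in>I - U. f j \<le> f l" "ranked f I ! r = f l"
    using hd xs by (metis imageI, simp)
  with \<open>l \<in> I - U\<close> show ?thesis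
    by blast
qed

text \<open>Any top set will do, whatever the ties: its values form the initial block of
  \<open>ranked f S\<close>, and \<open>take k\<close> cuts right after it. If \<open>k\<close>
  exceeds \<open>card S\<close>, the remaining block is empty.\<close>

lemma top_sum_eq_sum:
  assumes "finite S" "T \<subseteq> S" "card T = min k (card S)" "\<forall>i\<in>T. \<forall>j\<in>S - T. f j \<le> f i"
  shows "top_sum k f S = sum f T"
proof -
  have fin: "finite T" "finite (S - T)"
    using assms by (auto intro: finite_subset)
  have "ranked f S = ranked f T @ ranked f (S - T)"
    using ranked_Un[OF fin, of f] assms by (simp add: Un_absorb1)
  moreover have "card (S - T) = card S - card T"
    using assms fin by (simp add: card_Diff_subset)
  ultimately have "take k (ranked f S) = ranked f T"
    using assms fin by (cases "k \<le> card S") auto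
  then show ?thesis
    using fin by (simp add: top_sum_def sum_list_ranked)
qed

lemma top_sum_nonneg:
  assumes "finite S" "\<forall>i\<in>S. 0 \<le> f i"
  shows "0 \<le> top_sum k f S"
proof -
  have "\<forall>x\<in>set (ranked f S). 0 \<le> x" using assms by auto
  then show ?thesis
    unfolding top_sum_def by (intro sum_list_nonneg) (auto dest: in_set_takeD)
qed

text \<open>Greedy construction: a maximiser of \<open>f\<close> on the rest is added to a top set
  of size \<open>k\<close>.\<close>

lemma ex_top_set:
  fixes f :: "'i \<Rightarrow> real"
  assumes "finite S" "k \<le> card S"
  shows "\<exists>T\<subseteq>S. card T = k \<and> (\<forall>i\<in>T. \<forall>j\<in>S - T. f j \<le> f i)"
  using assms(2)
proof (induction k)
  case 0
  then show ?case by (intro exI[of _ "{}"]) auto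
next
  case (Suc k)
  then obtain T where T: "T \<subseteq> S" "card T = k" "\<forall>i\<in>T. \<forall>j\<in>S - T. f j \<le> f i"
    by auto
  have fin: "finite T" "finite (S - T)"
    using T assms(1) by (auto intro: finite_subset)
  have "S - T \<noteq> {}"
    using T Suc.prems fin card_mono[of T S] by fastforce
  then obtain m where m: "m \<in> S - T" "\<forall>j\<in>S - T. f j \<le> f m"
    using fin(2) Max_in[of "f ` (S - T)"] Max_ge[of "f ` (S - T)"]
    by (metis (no_types, lifting) finite_imageI image_eqI image_iff image_is_empty)
  show ?case
    by (rule exI[of _ "insert m T"]) (use T m fin in auto)
qed

text \<open>Exchange argument: the common part of \<open>T\<close> and \<open>U\<close> cancels, and
  \<open>p\<close> bounds what remains from above on \<open>T - U\<close> and from below on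
  \<open>U - T\<close>. It is applied with \<open>p\<close> the least value of a top set and with
  \<open>p\<close> the price.\<close>

lemma sum_diff_le_threshold:
  fixes f :: "'i \<Rightarrow> real"
  assumes "finite T" "finite U" "\<forall>i\<in>T - U. f i \<le> p" "\<forall>i\<in>U - T. p \<le> f i"
  shows "sum f T - sum f U \<le> p * (real (card T) - real (card U))"
proof -
  have "sum f T - sum f U = sum f (T - U) - sum f (U - T)"
    using assms sum.Int_Diff[of T f U] sum.Int_Diff[of U f T] by (simp add: Int_commute)
  also have "\<dots> \<le> real (card (T - U)) * p - real (card (U - T)) * p"
    using assms by (intro diff_mono sum_bounded_above sum_bounded_below) auto
  also have "\<dots> = p * (real (card T) - real (card U))"
  proof -
    have "card T = card (T \<inter> U) + card (T - U)" "card U = card (T \<inter> U) + card (U - T)"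
      using card_Int_Diff[OF assms(1), of U] card_Int_Diff[OF assms(2), of T]
      by (simp_all add: Int_commute)
    then show ?thesis by (simp add: algebra_simps)
  qed
  finally show ?thesis .
qed

lemma sum_le_top_sum:
  fixes f :: "'i \<Rightarrow> real"
  assumes "finite S" "U \<subseteq> S" "card U = min k (card S)"
  shows "sum f U \<le> top_sum k f S"
proof -
  obtain T where T: "T \<subseteq> S" "card T = min k (card S)" "\<forall>i\<in>T. \<forall>j\<in>S - T. f j \<le> f i"
    using ex_top_set[OF assms(1), of "min k (card S)" f] by auto
  have fin: "finite T" "finite U"
    using T assms by (auto intro: finite_subset)
  have "sum f U \<le> sum f T"
  proof (cases "T = {}")
    case True
    then show ?thesis using T assms fin by auto
  next
    case False
    \<comment> \<open>The least value on the top set separates it from the rest of \<open>S\<close>;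
      as \<open>U\<close> and \<open>T\<close> have equal size, the exchange bound is
      \<open>0\<close>.\<close>
    let ?p = "Min (f ` T)"
    have "?p \<in> f ` T" using False fin by simp
    then obtain t where "t \<in> T" "?p = f t" by auto
    moreover have "\<forall>i\<in>T. ?p \<le> f i" using fin by simp
    ultimately have "sum f U - sum f T \<le> ?p * (real (card U) - real (card T))"
      using T assms fin by (intro sum_diff_le_threshold) (auto simp del: Min_le_iff)
    then show ?thesis using T assms by simp
  qed
  then show ?thesis using top_sum_eq_sum[OF assms(1) T] by simp
qed

text \<open>Serves measurability: a maximum of finitely many sums of coordinates is visibly Borel,
  which the definition by sorting does not show.\<close>

lemma top_sum_eq_Max:
  fixes f :: "'i \<Rightarrow> real"
  assumes "finite S"
  shows "top_sum k f S = Max ((\<lambda>T. sum f T) ` {T. T \<subseteq> S \<and> card T = min k (card S)})"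
proof (rule Max_eqI[symmetric])
  show "finite (sum f ` {T. T \<subseteq> S \<and> card T = min k (card S)})"
    using assms by simp
  show "y \<le> top_sum k f S" if "y \<in> sum f ` {T. T \<subseteq> S \<and> card T = min k (card S)}" for y
    using that sum_le_top_sum[OF assms] by auto
  obtain T where "T \<subseteq> S" "card T = min k (card S)" "\<forall>i\<in>T. \<forall>j\<in>S - T. f j \<le> f i"
    using ex_top_set[OF assms, of "min k (card S)" f] by auto
  then show "top_sum k f S \<in> sum f ` {T. T \<subseteq> S \<and> card T = min k (card S)}"
    using top_sum_eq_sum[OF assms, of T k f] by auto
qed

lemma borel_measurable_top_sum:
  assumes "finite S"
  shows "(\<lambda>f. top_sum k f S) \<in> borel_measurable (PiM S (\<lambda>_. borel))"
  unfolding top_sum_eq_Max[OF assms]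
  by (intro borel_measurable_Max borel_measurable_sum measurable_component_singleton)
    (use assms in auto)

section \<open>The coalition against truthful bidders\<close>

lemma vcg_price_separates:
  assumes "finite I" "vcg_rule r I W" "\<forall>i\<in>I. 0 \<le> b i"
  shows "0 \<le> vcg_price r I b"
    and "i \<in> W b \<Longrightarrow> vcg_price r I b \<le> b i"
    and "j \<in> I - W b \<Longrightarrow> b j \<le> vcg_price r I b"
proof -
  have W: "W b \<subseteq> I" "card (W b) = min r (card I)" "\<forall>i\<in>W b. \<forall>j\<in>I - W b. b j \<le> b i"
    using assms by (auto simp: vcg_rule_def)
  have "0 \<le> vcg_price r I b \<and> (\<forall>i\<in>W b. vcg_price r I b \<le> b i)
    \<and> (\<forall>j\<in>I - W b. b j \<le> vcg_price r I b)"
  proof (cases "r < card I")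
    case True
    then obtain l where "l \<in> I - W b" "ranked b I ! r = b l" "\<forall>j\<in>I - W b. b j \<le> b l"
      using ranked_nth_separates[OF assms(1) W(1) _ True W(3)] W by auto
    then show ?thesis using True W assms by (auto simp: vcg_price_def)
  next
    \<comment> \<open>With at most \<open>r\<close> bidders everyone wins, so the default price
      \<open>0\<close> only has to lie below the bids.\<close>
    case False
    then have "W b = I" using W assms by (simp add: card_subset_eq)
    then show ?thesis using False assms by (simp add: vcg_price_def)
  qed
  then show "0 \<le> vcg_price r I b"
    and "i \<in> W b \<Longrightarrow> vcg_price r I b \<le> b i"
    and "j \<in> I - W b \<Longrightarrow> b j \<le> vcg_price r I b"
    by auto
qed

lemma optimal_utility_nonneg:
  assumes "finite A" "finite C" "vcg_rule r (A \<union> C) W"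
    and "\<forall>i\<in>A \<union> C. 0 \<le> v i" "optimal_bids r W A C v c"
  shows "0 \<le> coalition_utility r W A C v c"
proof -
  let ?z = "\<lambda>_::'a. 0::real"
  let ?b = "joint_bids C v ?z"
  have b: "\<forall>i\<in>A \<union> C. 0 \<le> ?b i"
    using assms by (auto simp: joint_bids_def)
  \<comment> \<open>Ties at bid \<open>0\<close> may still give items to a coalition that bids zero;
    then some winning bid is \<open>0\<close>, which caps the price at \<open>0\<close>.\<close>
  have price: "vcg_price r (A \<union> C) ?b = 0" if "coalition_items W C v ?z \<noteq> 0"
  proof -
    obtain i where i: "i \<in> W ?b" "i \<in> C"
      using \<open>coalition_items W C v ?z \<noteq> 0\<close> by (auto simp: coalition_items_def card_eq_0_iff)
    then have "?b i = 0" by (simp add: joint_bids_def)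
    then show ?thesis
      using vcg_price_separates(1)[OF _ assms(3) b]
        vcg_price_separates(2)[OF _ assms(3) b i(1)] assms(1,2)
      by simp
  qed
  have "0 \<le> coalition_utility r W A C v ?z"
    using price top_sum_nonneg[of C v "coalition_items W C v ?z"] assms(2,4)
    by (cases "coalition_items W C v ?z = 0") (simp_all add: coalition_utility_def)
  also have "\<dots> \<le> coalition_utility r W A C v c"
    using assms(5) by (simp add: optimal_bids_def)
  finally show ?thesis .
qed

lemma wel_opt_le_wel_vcg:
  assumes "finite A" "finite C" "A \<inter> C = {}" "vcg_rule r (A \<union> C) W"
    and "\<forall>i\<in>A \<union> C. 0 \<le> v i" "optimal_bids r W A C v c"
  shows "wel_opt r v A \<le> wel_vcg W A C v c"
proof -
  let ?b = "joint_bids C v c"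
  let ?p = "vcg_price r (A \<union> C) ?b"
  let ?k = "coalition_items W C v c"
  let ?U = "W ?b \<inter> A"
  have b: "\<forall>i\<in>A \<union> C. 0 \<le> ?b i"
    using assms by (auto simp: joint_bids_def optimal_bids_def)
  have W: "W ?b \<subseteq> A \<union> C" "card (W ?b) = min r (card (A \<union> C))"
    using assms(4) b by (auto simp: vcg_rule_def)
  note p = vcg_price_separates[OF _ assms(4) b]
  have bA: "?b i = v i" if "i \<in> A" for i
    using that assms(3) by (auto simp: joint_bids_def)
  obtain T where T: "T \<subseteq> A" "card T = min r (card A)" "\<forall>i\<in>T. \<forall>j\<in>A - T. v j \<le> v i"
    using ex_top_set[OF assms(1), of "min r (card A)" v] by auto
  have fin: "finite T" "finite (W ?b)"
    using T W assms by (auto intro: finite_subset)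
  have items: "card (W ?b) = card ?U + ?k"
  proof -
    have "W ?b = ?U \<union> (W ?b \<inter> C)" using W by auto
    also have "card \<dots> = card ?U + card (W ?b \<inter> C)"
      using fin assms(3) by (intro card_Un_disjoint) auto
    finally show ?thesis by (simp add: coalition_items_def)
  qed
  \<comment> \<open>\<open>T\<close> is an optimal allocation to \<open>A\<close> alone,
    \<open>?U\<close> the truthful winners. Members of \<open>A\<close> bid their valuations, so the
    price separates the losers \<open>T - ?U\<close> from the winners \<open>?U - T\<close>.\<close>
  have "sum v T - sum v ?U \<le> ?p * (real (card T) - real (card ?U))"
  proof (rule sum_diff_le_threshold)
    show "\<forall>i\<in>T - ?U. v i \<le> ?p"
      using p(3) assms(1,2) T(1) bA by (metis Diff_iff IntI UnI1 finite_Un subsetD)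
    show "\<forall>i\<in>?U - T. ?p \<le> v i"
      using p(2) assms(1,2) bA by (metis Diff_iff IntE finite_Un)
  qed (use fin in auto)
  also have "\<dots> \<le> ?p * real ?k"
  proof (rule mult_left_mono)
    \<comment> \<open>Serving the larger set \<open>A \<union> C\<close> never sells fewer items, so
      \<open>T\<close> outnumbers \<open>?U\<close> by at most the \<open>?k\<close> items of the
      coalition.\<close>
    have "card A \<le> card (A \<union> C)" using assms by (intro card_mono) auto
    then show "real (card T) - real (card ?U) \<le> real ?k"
      using T(2) W(2) items by linarith
  qed (use p(1) assms in auto)
  also have "\<dots> \<le> top_sum ?k v C"
    using optimal_utility_nonneg[OF assms(1,2,4-6)]
    by (simp add: coalition_utility_def mult.commute)
  finally show ?thesis
    using top_sum_eq_sum[OF assms(1) T] by (simp add: wel_opt_def wel_vcg_def)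
qed

section \<open>Exchangeability\<close>

text \<open>By independence the joint law over \<open>K\<close> is a product of copies of
  \<open>\<mu>\<close>; selecting and renaming coordinates along an injection turns it into the
  product over \<open>J\<close>.\<close>

lemma (in prob_space) distr_iid_reindex:
  assumes "indep_vars (\<lambda>_. L) X K" "\<And>i. i \<in> K \<Longrightarrow> distr M L (X i) = \<mu>"
    and "inj_on f J" "f ` J \<subseteq> K" "K \<noteq> {}"
  shows "distr M (PiM J (\<lambda>_. L)) (\<lambda>\<omega>. \<lambda>i\<in>J. X (f i) \<omega>) = PiM J (\<lambda>_. \<mu>)"
proof -
  have rv: "random_variable L (X i)" if "i \<in> K" for i
    using assms(1) that by (simp add: indep_vars_def)
  obtain i where "i \<in> K" using assms(5) by auto
  then have prob: "prob_space \<mu>" and sets: "sets \<mu> = sets L"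
    using prob_space_distr[OF rv[of i]] assms(2)[of i] by auto
  \<comment> \<open>\<open>distr\<close> depends on its target only through the measurable sets, so
    \<open>L\<close> and \<open>\<mu>\<close> may be interchanged there.\<close>
  have setsP: "sets (PiM I (\<lambda>_. \<mu>)) = sets (PiM I (\<lambda>_. L))" for I :: "'d set"
    by (intro sets_PiM_cong refl sets)
  have PK: "distr M (PiM K (\<lambda>_. L)) (\<lambda>\<omega>. \<lambda>i\<in>K. X i \<omega>) = PiM K (\<lambda>_. \<mu>)"
    using indep_vars_iff_distr_eq_PiM'[OF assms(5) rv] assms(1,2)
    by (simp cong: PiM_cong)
  have mX: "(\<lambda>\<omega>. \<lambda>i\<in>K. X i \<omega>) \<in> measurable M (PiM K (\<lambda>_. L))"
    using rv by (intro measurable_restrict)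
  have mf: "(\<lambda>\<omega>. \<lambda>n\<in>J. \<omega> (f n)) \<in> measurable (PiM K (\<lambda>_. L)) (PiM J (\<lambda>_. L))"
    using assms(4) by (intro measurable_restrict measurable_component_singleton) auto
  have "PiM J (\<lambda>_. \<mu>) = distr (PiM K (\<lambda>_. \<mu>)) (PiM J (\<lambda>_. \<mu>)) (\<lambda>\<omega>. \<lambda>n\<in>J. \<omega> (f n))"
    using assms(3,4) prob by (intro distr_PiM_reindex[symmetric]) auto
  also have "\<dots> = distr (PiM K (\<lambda>_. \<mu>)) (PiM J (\<lambda>_. L)) (\<lambda>\<omega>. \<lambda>n\<in>J. \<omega> (f n))"
    by (intro distr_cong refl sets_PiM_cong sets)
  also have "\<dots> = distr M (PiM J (\<lambda>_. L)) ((\<lambda>\<omega>. \<lambda>n\<in>J. \<omega> (f n)) \<circ> (\<lambda>\<omega>. \<lambda>i\<in>K. X i \<omega>))"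
    unfolding PK[symmetric] by (rule distr_distr[OF mf mX])
  also have "(\<lambda>\<omega>. \<lambda>n\<in>J. \<omega> (f n)) \<circ> (\<lambda>\<omega>. \<lambda>i\<in>K. X i \<omega>) = (\<lambda>\<omega>. \<lambda>i\<in>J. X (f i) \<omega>)"
    using assms(4) by (auto simp: fun_eq_iff restrict_def image_subset_iff)
  finally show ?thesis ..
qed

text \<open>The right-hand side is free of \<open>f\<close>: any two injections of \<open>J\<close>
  into \<open>K\<close> pick groups of bidders with the same expected optimal welfare.\<close>

lemma (in prob_space) nn_integral_top_sum_iid:
  fixes X :: "'i \<Rightarrow> 'a \<Rightarrow> real"
  assumes "indep_vars (\<lambda>_. borel) X K" "\<And>i. i \<in> K \<Longrightarrow> distr M borel (X i) = \<mu>"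
    and "finite J" "inj_on f J" "f ` J \<subseteq> K" "K \<noteq> {}"
  shows "(\<integral>\<^sup>+\<omega>. ennreal (top_sum k (\<lambda>i. X i \<omega>) (f ` J)) \<partial>M)
    = (\<integral>\<^sup>+x. ennreal (top_sum k x J) \<partial>PiM J (\<lambda>_. \<mu>))"
proof -
  have rv: "random_variable borel (X i)" if "i \<in> K" for i
    using assms(1) that by (simp add: indep_vars_def)
  have "top_sum k (\<lambda>i. X i \<omega>) (f ` J) = top_sum k (\<lambda>i\<in>J. X (f i) \<omega>) J" for \<omega>
    using ranked_cong[of J "(\<lambda>i. X i \<omega>) \<circ> f" "\<lambda>i\<in>J. X (f i) \<omega>"]
    by (simp add: top_sum_def ranked_image[OF assms(4)])
  then have "(\<integral>\<^sup>+\<omega>. ennreal (top_sum k (\<lambda>i. X i \<omega>) (f ` J)) \<partial>M)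
      = (\<integral>\<^sup>+\<omega>. ennreal (top_sum k (\<lambda>i\<in>J. X (f i) \<omega>) J) \<partial>M)"
    by simp
  also have "\<dots> = (\<integral>\<^sup>+x. ennreal (top_sum k x J)
      \<partial>distr M (PiM J (\<lambda>_. borel)) (\<lambda>\<omega>. \<lambda>i\<in>J. X (f i) \<omega>))"
    using assms(5) rv borel_measurable_top_sum[OF assms(3), of k]
    by (intro nn_integral_distr[symmetric] measurable_restrict) auto
  also have "distr M (PiM J (\<lambda>_. borel)) (\<lambda>\<omega>. \<lambda>i\<in>J. X (f i) \<omega>) = PiM J (\<lambda>_. \<mu>)"
    using assms by (intro distr_iid_reindex) auto
  finally show ?thesis .
qed

theorem proposition3p2:
  fixes M :: "'w measure"
    and r :: nat
    and N C N' :: "'i set"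
    and V :: "'i \<Rightarrow> 'w \<Rightarrow> real"
    and W :: "('i \<Rightarrow> real) \<Rightarrow> 'i set"
    and B :: "'w \<Rightarrow> 'i \<Rightarrow> real"
  assumes "r \<ge> 1"
    and "finite N" "finite C" "finite N'"
    and "N \<inter> C = {}" "N \<inter> N' = {}" "C \<inter> N' = {}"
    and "card N' = card C"
    and "prob_space M"
    and "prob_space.indep_vars M (\<lambda>_. borel) V (N \<union> C \<union> N')"
    and "\<forall>i\<in>N \<union> C \<union> N'. \<forall>j\<in>N \<union> C \<union> N'. distr M borel (V i) = distr M borel (V j)"
    and "\<forall>i\<in>N \<union> C \<union> N'. \<forall>\<omega>\<in>space M. 0 \<le> V i \<omega>"
    and "vcg_rule r (N \<union> N' \<union> C) W"
    and "\<forall>\<omega>\<in>space M. optimal_bids r W (N \<union> N') C (\<lambda>i. V i \<omega>) (B \<omega>)"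
    and "\<forall>\<omega>\<in>space M. \<forall>i\<in>C. B \<omega> i = 0 \<or> B \<omega> i = V i \<omega>"
  shows "(\<integral>\<^sup>+\<omega>. ennreal (wel_vcg W (N \<union> N') C (\<lambda>i. V i \<omega>) (B \<omega>)) \<partial>M)
       \<ge> (\<integral>\<^sup>+\<omega>. ennreal (wel_opt r (\<lambda>i. V i \<omega>) (N \<union> C)) \<partial>M)"
proof -
  interpret prob_space M by fact
  let ?K = "N \<union> C \<union> N'"
  have "(\<integral>\<^sup>+\<omega>. ennreal (wel_opt r (\<lambda>i. V i \<omega>) (N \<union> C)) \<partial>M)
      = (\<integral>\<^sup>+\<omega>. ennreal (wel_opt r (\<lambda>i. V i \<omega>) (N \<union> N')) \<partial>M)"
  \<comment> \<open>The common law \<open>\<mu>\<close> is read off some bidder, so the case without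
    bidders is split off; there both sides rank the empty set.\<close>
  proof (cases "?K = {}")
    case True
    then show ?thesis by simp
  next
    case False
    then obtain i0 where i0: "i0 \<in> ?K" by blast
    define \<mu> where "\<mu> = distr M borel (V i0)"
    have \<mu>: "distr M borel (V i) = \<mu>" if "i \<in> ?K" for i
      using assms(11) that i0 unfolding \<mu>_def by blast
    have "card (N \<union> C) = card (N \<union> N')"
      using assms(2-8) by (simp add: card_Un_disjoint)
    then obtain g where g: "bij_betw g (N \<union> C) (N \<union> N')"
      using assms(2-4) finite_same_card_bij[of "N \<union> C" "N \<union> N'"] by auto
    have "(\<integral>\<^sup>+\<omega>. ennreal (top_sum r (\<lambda>i. V i \<omega>) (f ` (N \<union> C))) \<partial>M)
        = (\<integral>\<^sup>+x. ennreal (top_sum r x (N \<union> C)) \<partial>PiM (N \<union> C) (\<lambda>_. \<mu>))"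
      if "inj_on f (N \<union> C)" "f ` (N \<union> C) \<subseteq> ?K" for f
      using that assms(2,3) False by (intro nn_integral_top_sum_iid[OF assms(10) \<mu>]) auto
    \<comment> \<open>\<open>id\<close> yields \<open>N \<union> C\<close> itself and
      \<open>g\<close> maps it onto \<open>N \<union> N'\<close>, so both expectations equal the
      same integral over the product law.\<close>
    from this[of id] this[of g] show ?thesis
      using bij_betw_imp_inj_on[OF g] bij_betw_imp_surj_on[OF g]
      by (simp add: wel_opt_def Un_assoc Un_left_commute subset_iff)
  qed
  \<comment> \<open>The comparison is pointwise, and \<open>nn_integral_mono\<close> asks for no
    measurability, which suits the arbitrary choices made by \<open>W\<close> and
    \<open>B\<close>.\<close>
  also have "\<dots> \<le> (\<integral>\<^sup>+\<omega>. ennreal (wel_vcg W (N \<union> N') C (\<lambda>i. V i \<omega>) (B \<omega>)) \<partial>M)"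
    using assms(2-7,12-14) by (intro nn_integral_mono ennreal_leI wel_opt_le_wel_vcg) auto
  finally show ?thesis .
qed

end
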